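(* Let $a<b$ be real numbers and let $f:[a,b]\to\mathbb{R}$ be a function of bounded variation on $[a,b]$. Then for every real $p\ge 1$, $$\|f\|_{[a,b],p}\le \frac{1}{(b-a)^{1-\frac1p}}\left|\int_a^b f(t)\,dt\right|+\frac12\cdot\frac{(b-a)^{\frac1p}\left(2^{p+1}-1\right)^{\frac1p}}{(p+1)^{\frac1p}}\bigvee\nolimits_a^b(f).$$ The constant $\frac12$ is best possible in the sense that it cannot be replaced by a smaller quantity; that is, if $D>0$ is a constant such that $$\|f\|_{[a,b],p}\le \frac{1}{(b-a)^{1-\frac1p}}\left|\int_a^b f(t)\,dt\right|+D\cdot\frac{(b-a)^{\frac1p}\left(2^{p+1}-1\right)^{\frac1p}}{(p+1)^{\frac1p}}\bigvee\nolimits_a^b(f)$$ holds for all $p\ge1$, all $a<b$ and all functions $f:[a,b]\to\mathbb{R}$ of bounded variation, then $D\ge\frac12$.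
   Context: $\|f\|_{[a,b],p}:=\left(\int_a^b|f(t)|^p\,dt\right)^{1/p}$ for $p\ge1$. $\bigvee_a^b(f)$ denotes the total variation of $f$ on $[a,b]$. *)

theory Defs
  imports "HOL-Analysis.Analysis"
begin

text \<open>Functions on an interval $[a,b]$ are represented by total functions on the reals; the notions
  below depend only on the values on \<open>{a..b}\<close>.\<close>

definition variation_sums :: "real \<Rightarrow> real \<Rightarrow> (real \<Rightarrow> real) \<Rightarrow> real set" where
  "variation_sums a b f =
     {\<Sum>i<n. \<bar>f (x (Suc i)) - f (x i)\<bar> | (n::nat) (x::nat \<Rightarrow> real).
        x 0 = a \<and> x n = b \<and> (\<forall>i<n. x i < x (Suc i))}"

definition bounded_variation_on :: "real \<Rightarrow> real \<Rightarrow> (real \<Rightarrow> real) \<Rightarrow> bool" where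
  "bounded_variation_on a b f \<longleftrightarrow> bdd_above (variation_sums a b f)"

text \<open>Meaningful only when \<open>bounded_variation_on a b f\<close> holds, since the supremum is taken in
  the reals.\<close>

definition total_variation :: "real \<Rightarrow> real \<Rightarrow> (real \<Rightarrow> real) \<Rightarrow> real" where
  "total_variation a b f = Sup (variation_sums a b f)"

text \<open>The integral is the Henstock--Kurzweil one. A function \<open>f\<close> of bounded variation and the
  power \<open>\<bar>f\<bar>\<^sup>p\<close> are Riemann integrable, so there it agrees with the Riemann and Lebesgue
  integrals.\<close>

definition Lp_norm_on :: "real \<Rightarrow> real \<Rightarrow> real \<Rightarrow> (real \<Rightarrow> real) \<Rightarrow> real" where
  "Lp_norm_on a b p f = (integral {a..b} (\<lambda>t. \<bar>f t\<bar> powr p)) powr (1 / p)"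

end

theory Submission
  imports Defs "HOL-Real_Asymp.Real_Asymp"
begin

text \<open>If \<open>V\<close> is the total variation of \<open>f\<close> and \<open>\<mu>\<close> its mean value, then
  \<open>\<bar>f t - f s\<bar>\<close> is at most the variation of \<open>f\<close> between \<open>s\<close> and \<open>t\<close>. Averaging over \<open>s\<close> gives
  \<open>\<bar>f t - \<mu>\<bar> \<le> max (t - a) (b - t) / (b - a) * V\<close>, and Minkowski's inequality applied to
  \<open>\<bar>f t\<bar> \<le> \<bar>\<mu>\<bar> + max (t - a) (b - t) / (b - a) * V\<close> yields the bound. For sharpness, take the
  characteristic function of \<open>[0, 1/p]\<close> on \<open>[0, 1]\<close>: since \<open>(2 powr (p + 1) - 1) / (p + 1)\<close> is at most
  \<open>2 powr p\<close>, the inequality forces \<open>(1/p) powr (1/p) \<le> 1/p + 2 * D\<close>; let \<open>p\<close> tend to infinity.\<close>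

section \<open>Functions of bounded variation\<close>

text \<open>Partition points increase strictly, so a chain returning to \<open>a\<close> has no
  steps and only the empty sum remains. Hence the variation function vanishes at its left
  endpoint.\<close>

lemma variation_sums_self: "variation_sums a a f = {0}"
proof (intro equalityI subsetI)
  fix v
  assume "v \<in> variation_sums a a f"
  then obtain n x where nx: "v = (\<Sum>i<n. \<bar>f (x (Suc i)) - f (x i)\<bar>)" "x 0 = a" "x n = a"
    "\<forall>i<n. x i < x (Suc i)"
    unfolding variation_sums_def by blast
  have "x 0 < x i" if "i \<le> n" "i \<noteq> 0" for i
    using that
  proof (induction i)
    case (Suc i)
    then have "x i < x (Suc i)" using nx(4) by simp
    with Suc show ?case by (cases "i = 0") simp_all
  qed simp
  from this[of n] nx(2,3) have "n = 0" by (cases "n = 0") simp_all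
  with nx(1) show "v \<in> {0}" by simp
next
  fix v :: real
  assume "v \<in> {0}"
  then show "v \<in> variation_sums a a f"
    unfolding variation_sums_def by (intro CollectI exI[of _ 0] exI[of _ "\<lambda>_. a"]) simp
qed

text \<open>Appending \<open>t\<close> as a last node to a partition ending at \<open>s\<close> adds
  exactly one summand. Boundedness on subintervals and monotonicity of the variation function both
  rest on this.\<close>

lemma variation_sums_extend:
  assumes "v \<in> variation_sums a s f" "s < t"
  shows "v + \<bar>f t - f s\<bar> \<in> variation_sums a t f"
proof -
  obtain n x where nx: "v = (\<Sum>i<n. \<bar>f (x (Suc i)) - f (x i)\<bar>)" "x 0 = a" "x n = s"
    "\<forall>i<n. x i < x (Suc i)"
    using assms(1) by (auto simp: variation_sums_def)
  let ?y = "x(Suc n := t)"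
  have "v + \<bar>f t - f s\<bar> = (\<Sum>i<Suc n. \<bar>f (?y (Suc i)) - f (?y i)\<bar>)"
    using nx(1,3) by simp
  moreover have "?y 0 = a" "?y (Suc n) = t" "\<forall>i<Suc n. ?y i < ?y (Suc i)"
    using nx assms(2) by (auto simp: less_Suc_eq)
  ultimately show ?thesis unfolding variation_sums_def by blast
qed

lemma variation_sums_nonempty: "a \<le> b \<Longrightarrow> variation_sums a b f \<noteq> {}"
  using variation_sums_extend[of 0 a a f b] variation_sums_self[of a f]
  by (cases "a = b") auto

lemma bounded_variation_on_subinterval:
  assumes "bounded_variation_on a b f" "t \<le> b"
  shows "bounded_variation_on a t f"
proof (cases "t = b")
  case False
  obtain M where M: "\<And>v. v \<in> variation_sums a b f \<Longrightarrow> v \<le> M"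
    using assms(1) by (auto simp: bounded_variation_on_def bdd_above_def)
  have "v \<le> M" if "v \<in> variation_sums a t f" for v
    using M[OF variation_sums_extend[OF that]] False assms(2) by fastforce
  then show ?thesis by (auto simp: bounded_variation_on_def bdd_above_def)
qed (use assms in simp)

lemma total_variation_self: "total_variation a a f = 0"
  by (simp add: total_variation_def variation_sums_self)

text \<open>Every partition of \<open>{a..s}\<close> is extended by the node \<open>t\<close>; then
  the supremum is taken over the partitions of \<open>{a..s}\<close>. The result makes the variation
  function increasing and lets it dominate the increments of \<open>f\<close>.\<close>

lemma abs_diff_le_total_variation_diff:
  assumes "bounded_variation_on a b f" "a \<le> s" "s \<le> t" "t \<le> b"
  shows "\<bar>f t - f s\<bar> \<le> total_variation a t f - total_variation a s f"
proof (cases "s = t")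
  case False
  have bdd: "bdd_above (variation_sums a t f)"
    using bounded_variation_on_subinterval[OF assms(1,4)] by (simp add: bounded_variation_on_def)
  have "v \<le> total_variation a t f - \<bar>f t - f s\<bar>" if "v \<in> variation_sums a s f" for v
    using cSup_upper[OF variation_sums_extend[OF that, of t] bdd] False assms(3)
    by (simp add: total_variation_def)
  then have "total_variation a s f \<le> total_variation a t f - \<bar>f t - f s\<bar>"
    unfolding total_variation_def[of a s]
    by (intro cSup_least variation_sums_nonempty assms(2))
  then show ?thesis by simp
qed simp

text \<open>The summands \<open>W\<close> and \<open>W - f\<close> of the Jordan decomposition are monotone, where \<open>W\<close> is the
  variation function.\<close>

lemma bounded_variation_on_measurable:
  assumes "bounded_variation_on a b f"
  shows "f \<in> borel_measurable (lebesgue_on {a..b})"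
proof -
  define W where "W t = total_variation a t f" for t
  have diff: "\<bar>f t - f s\<bar> \<le> W t - W s" if "a \<le> s" "s \<le> t" "t \<le> b" for s t
    using abs_diff_le_total_variation_diff[OF assms that] by (simp add: W_def)
  have mono: "mono_on {a..b} W" "mono_on {a..b} (\<lambda>t. W t - f t)"
    by (intro mono_onI; use diff in force)+
  from borel_measurable_diff[OF mono[THEN integrable_mono_on, THEN borel_measurable_integrable]]
  show ?thesis by simp
qed

lemma bounded_variation_on_bounded:
  assumes "bounded_variation_on a b f" "t \<in> {a..b}"
  shows "\<bar>f t\<bar> \<le> \<bar>f a\<bar> + total_variation a b f"
  using abs_diff_le_total_variation_diff[OF assms(1), of a t]
    abs_diff_le_total_variation_diff[OF assms(1), of t b] assms(2)
  by (auto simp: total_variation_self)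

lemma bounded_variation_on_integrable:
  assumes "bounded_variation_on a b f"
  shows "f integrable_on {a..b}"
  by (rule measurable_bounded_by_integrable_imp_integrable_real
      [OF bounded_variation_on_measurable[OF assms], where g = "\<lambda>_. \<bar>f a\<bar> + total_variation a b f"])
    (use bounded_variation_on_bounded[OF assms] in auto)

lemma bounded_variation_on_powr_integrable:
  assumes "bounded_variation_on a b f" "p \<ge> 0"
  shows "(\<lambda>t. \<bar>f t\<bar> powr p) integrable_on {a..b}"
proof (rule measurable_bounded_by_integrable_imp_integrable_real)
  show "(\<lambda>t. \<bar>f t\<bar> powr p) \<in> borel_measurable (lebesgue_on {a..b})"
    using bounded_variation_on_measurable[OF assms(1)] by measurable
  show "\<bar>\<bar>f t\<bar> powr p\<bar> \<le> (\<bar>f a\<bar> + total_variation a b f) powr p" if "t \<in> {a..b}" for t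
    using bounded_variation_on_bounded[OF assms(1) that] assms(2) by (simp add: powr_mono2)
qed auto

section \<open>Pointwise bound through the mean value\<close>

lemma abs_integral_minus_le:
  fixes f :: "real \<Rightarrow> real"
  assumes f: "f integrable_on {a..b}" and t: "t \<in> {a..b}"
    and le: "\<And>s. s \<in> {a..t} \<Longrightarrow> \<bar>c - f s\<bar> \<le> \<alpha>" and ge: "\<And>s. s \<in> {t..b} \<Longrightarrow> \<bar>c - f s\<bar> \<le> \<beta>"
  shows "\<bar>c * (b - a) - integral {a..b} f\<bar> \<le> (t - a) * \<alpha> + (b - t) * \<beta>"
proof -
  have int: "f integrable_on {a..t}" "f integrable_on {t..b}"
    using f t by (auto intro: integrable_subinterval_real)
  \<comment> \<open>The integral is split at \<open>t\<close> so that each side keeps its own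
    bound.\<close>
  have "norm (integral {a..t} (\<lambda>s. c - f s)) \<le> integral {a..t} (\<lambda>_. \<alpha>)"
    "norm (integral {t..b} (\<lambda>s. c - f s)) \<le> integral {t..b} (\<lambda>_. \<beta>)"
    using le ge by (intro integral_norm_bound_integral integrable_diff int integrable_const_ivl; simp)+
  moreover have "integral {a..t} (\<lambda>s. c - f s) = c * (t - a) - integral {a..t} f"
    "integral {t..b} (\<lambda>s. c - f s) = c * (b - t) - integral {t..b} f"
    using int t by (simp_all add: Henstock_Kurzweil_Integration.integral_diff integrable_const_ivl)
  moreover have "integral {a..b} f = integral {a..t} f + integral {t..b} f"
    using f t by (simp add: Henstock_Kurzweil_Integration.integral_combine)
  ultimately show ?thesis using t by (simp add: algebra_simps)
qed

text \<open>With \<open>W\<close> the variation function, \<open>f s\<close> differs from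
  \<open>f t\<close> by at most \<open>W t\<close> for \<open>s\<close> left of \<open>t\<close> and
  by at most \<open>W b - W t\<close> for \<open>s\<close> right of it. These bounds add up to
  \<open>W b\<close>, so replacing both lengths by the larger one removes the dependence on
  \<open>W t\<close>.\<close>

lemma bounded_variation_on_mean_bound:
  assumes "bounded_variation_on a b f" "a < b" "t \<in> {a..b}"
  shows "\<bar>f t\<bar> \<le> \<bar>integral {a..b} f\<bar> / (b - a) + total_variation a b f / (b - a) * max (t - a) (b - t)"
proof -
  define W where "W t = total_variation a t f" for t
  have diff: "\<bar>f t - f s\<bar> \<le> W t - W s" if "a \<le> s" "s \<le> t" "t \<le> b" for s t
    using abs_diff_le_total_variation_diff[OF assms(1) that] by (simp add: W_def)
  have W: "0 \<le> W s" if "s \<in> {a..b}" for s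
    using diff[of a s] that by (simp add: W_def total_variation_self)
  have Wt: "0 \<le> W t" "W t \<le> W b"
    using W[OF assms(3)] diff[of t b] assms(3) by auto
  have "\<bar>f t * (b - a) - integral {a..b} f\<bar> \<le> (t - a) * W t + (b - t) * (W b - W t)"
  proof (rule abs_integral_minus_le[OF bounded_variation_on_integrable[OF assms(1)] assms(3)])
    show "\<bar>f t - f s\<bar> \<le> W t" if "s \<in> {a..t}" for s
      using diff[of s t] W[of s] that assms(3) by auto
    show "\<bar>f t - f s\<bar> \<le> W b - W t" if "s \<in> {t..b}" for s
      using diff[of t s] diff[of s b] that assms(3) by auto
  qed
  also have "\<dots> \<le> max (t - a) (b - t) * W t + max (t - a) (b - t) * (W b - W t)"
    using Wt by (intro add_mono mult_right_mono) auto
  also have "\<dots> = W b * max (t - a) (b - t)"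
    by (simp add: algebra_simps)
  finally have "\<bar>f t\<bar> * (b - a) \<le> \<bar>integral {a..b} f\<bar> + W b * max (t - a) (b - t)"
    using assms(2) abs_mult[of "f t" "b - a"] by linarith
  then show ?thesis
    using assms(2) by (simp add: W_def pos_le_divide_eq add_divide_distrib[symmetric])
qed

section \<open>Minkowski's inequality\<close>

text \<open>Between positive points this is \<open>powr_convex\<close>. Only the smaller point
  \<open>x\<close> can be 0, and then the claim becomes
  \<open>(t * y) powr p \<le> t * y powr p\<close>, which follows from
  \<open>t powr p \<le> t\<close>.\<close>

lemma powr_convex_nonneg:
  assumes "p \<ge> 1"
  shows "convex_on {0..} (\<lambda>x::real. x powr p)"
proof -
  have scale: "(t * x) powr p \<le> t * x powr p" if "0 \<le> t" "t \<le> 1" "0 \<le> x" for t x :: real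
  proof -
    have "t powr p \<le> t"
      using that(1,2) assms powr_mono'[of 1 p t] by simp
    then show ?thesis using that by (simp add: powr_mult mult_right_mono)
  qed
  show ?thesis
  proof (rule convex_on_linorderI)
    fix t x y :: real
    assume *: "0 < t" "t < 1" "x \<in> {0..}" "y \<in> {0..}" "x < y"
    show "((1 - t) *\<^sub>R x + t *\<^sub>R y) powr p \<le> (1 - t) * x powr p + t * y powr p"
    proof (cases "x = 0")
      case True
      then show ?thesis using * scale[of t y] assms by simp
    next
      case False
      then show ?thesis using convex_onD[OF powr_convex[OF assms], of t x y] * by simp
    qed
  qed simp
qed

text \<open>For \<open>A\<close> and \<open>B\<close> slightly above the two norms,
  \<open>f + g\<close> is \<open>A + B\<close> times a convex combination of \<open>f / A\<close>
  and \<open>g / B\<close>. Convexity of the power applies pointwise, and the powers of both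
  quotients have integral at most 1.\<close>

lemma Minkowski_inequality_integral:
  fixes f g :: "'a::euclidean_space \<Rightarrow> real"
  assumes p: "p \<ge> 1"
    and nonneg: "\<And>x. x \<in> S \<Longrightarrow> 0 \<le> f x" "\<And>x. x \<in> S \<Longrightarrow> 0 \<le> g x"
    and f: "(\<lambda>x. f x powr p) integrable_on S" and g: "(\<lambda>x. g x powr p) integrable_on S"
    and fg: "(\<lambda>x. (f x + g x) powr p) integrable_on S"
  shows "(integral S (\<lambda>x. (f x + g x) powr p)) powr (1 / p)
    \<le> (integral S (\<lambda>x. f x powr p)) powr (1 / p) + (integral S (\<lambda>x. g x powr p)) powr (1 / p)"
    (is "?I powr _ \<le> ?F powr _ + ?G powr _")
proof (rule field_le_epsilon)
  fix e :: real
  assume e: "e > 0"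
  \<comment> \<open>Adding \<open>e / 2\<close> avoids the degenerate cases of a vanishing norm.\<close>
  define A B where "A = ?F powr (1 / p) + e / 2" and "B = ?G powr (1 / p) + e / 2"
  have AB: "A > 0" "B > 0" using e by (auto simp: A_def B_def add_nonneg_pos)
  have nn: "?F \<ge> 0" "?G \<ge> 0" "?I \<ge> 0"
    by (intro integral_nonneg f g fg; simp)+
  have root: "(x powr (1 / p)) powr p = x" if "x \<ge> 0" for x
    using that p by (simp add: powr_powr)
  have le: "?F \<le> A powr p" "?G \<le> B powr p"
    using powr_mono2[of p "?F powr (1 / p)" A] powr_mono2[of p "?G powr (1 / p)" B] p e
    by (simp_all add: A_def B_def root nn)
  \<comment> \<open>With this weight both \<open>(1 - t) / A\<close> and \<open>t / B\<close> equal
    \<open>1 / (A + B)\<close>.\<close>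
  define t where "t = B / (A + B)"
  have t: "0 \<le> t" "t \<le> 1" "1 - t = A / (A + B)"
    using AB by (auto simp: t_def field_simps)
  have "(f x + g x) powr p
      \<le> (A + B) powr p * ((1 - t) / A powr p * f x powr p + t / B powr p * g x powr p)"
    if x: "x \<in> S" for x
  proof -
    have "f x + g x = (A + B) * ((1 - t) * (f x / A) + t * (g x / B))"
    proof -
      have "(1 - t) * (f x / A) = f x / (A + B)" "t * (g x / B) = g x / (A + B)"
        using AB unfolding t(3) by (simp_all add: t_def)
      then show ?thesis using AB by (simp add: add_divide_distrib[symmetric])
    qed
    then have "(f x + g x) powr p = (A + B) powr p * ((1 - t) * (f x / A) + t * (g x / B)) powr p"
      using AB nonneg[OF x] t by (simp add: powr_mult)
    moreover have "((1 - t) * (f x / A) + t * (g x / B)) powr p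
        \<le> (1 - t) * (f x / A) powr p + t * (g x / B) powr p"
      using convex_onD[OF powr_convex_nonneg[OF p] t(1,2), of "f x / A" "g x / B"] nonneg[OF x] AB
      by simp
    ultimately show ?thesis
      using AB nonneg[OF x] by (simp add: powr_divide)
  qed
  then have "?I \<le> integral S (\<lambda>x. (A + B) powr p *
      ((1 - t) / A powr p * f x powr p + t / B powr p * g x powr p))"
    by (intro integral_le fg integrable_on_mult_right integrable_add f g) auto
  also have "\<dots> = (A + B) powr p * ((1 - t) / A powr p * ?F + t / B powr p * ?G)"
    by (intro integral_unique has_integral_mult_right has_integral_add integrable_integral f g)
  also have "\<dots> \<le> (A + B) powr p * ((1 - t) / A powr p * A powr p + t / B powr p * B powr p)"
    using t(1,2) le by (intro mult_left_mono add_mono) auto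
  also have "\<dots> = (A + B) powr p"
    using AB by simp
  finally have "?I powr (1 / p) \<le> ((A + B) powr p) powr (1 / p)"
    using nn p by (intro powr_mono2) auto
  also have "\<dots> = A + B"
    using AB p by (simp add: powr_powr)
  finally show "?I powr (1 / p) \<le> ?F powr (1 / p) + ?G powr (1 / p) + e"
    by (simp add: A_def B_def)
qed

text \<open>The maximum switches from \<open>b - t\<close> to \<open>t - a\<close> at the midpoint.
  On each half the base is at least \<open>(b - a) / 2 > 0\<close>, so the antiderivative is
  differentiable up to the ends, and by symmetry both halves contribute the same value
  \<open>H\<close>.\<close>

lemma has_integral_max_powr:
  fixes a b p :: real
  assumes "a < b" "p \<ge> 0"
  shows "((\<lambda>t. max (t - a) (b - t) powr p) has_integral
    (b - a) powr (p + 1) * (2 powr (p + 1) - 1) / ((p + 1) * 2 powr p)) {a..b}"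
proof -
  define m where "m = (a + b) / 2"
  have m: "a < m" "m < b" "b - m = (b - a) / 2" "m - a = (b - a) / 2"
    using assms(1) by (auto simp: m_def field_simps)
  define H where "H = (b - a) powr (p + 1) / (p + 1) - ((b - a) / 2) powr (p + 1) / (p + 1)"
  have "((\<lambda>t. (b - t) powr p) has_integral
      - ((b - m) powr (p + 1) / (p + 1)) - (- ((b - a) powr (p + 1) / (p + 1)))) {a..m}"
    using m assms by (intro fundamental_theorem_of_calculus)
      (auto intro!: derivative_eq_intros simp flip: has_real_derivative_iff_has_vector_derivative)
  then have 1: "((\<lambda>t. max (t - a) (b - t) powr p) has_integral H) {a..m}"
    unfolding H_def m(3) by (rule has_integral_eq_rhs[OF has_integral_eq, rotated])
      (auto simp: max_def m_def)
  have "((\<lambda>t. (t - a) powr p) has_integral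
      (b - a) powr (p + 1) / (p + 1) - (m - a) powr (p + 1) / (p + 1)) {m..b}"
    using m assms by (intro fundamental_theorem_of_calculus)
      (auto intro!: derivative_eq_intros simp flip: has_real_derivative_iff_has_vector_derivative)
  then have 2: "((\<lambda>t. max (t - a) (b - t) powr p) has_integral H) {m..b}"
    unfolding H_def m(4) by (rule has_integral_eq_rhs[OF has_integral_eq, rotated])
      (auto simp: max_absorb1 m_def)
  have "H + H = (b - a) powr (p + 1) * (2 powr (p + 1) - 1) / ((p + 1) * 2 powr p)"
  proof -
    have "(K / (p + 1) - K / (2 * P) / (p + 1)) + (K / (p + 1) - K / (2 * P) / (p + 1))
        = K * (2 * P - 1) / ((p + 1) * P)" if "P > 0" for K P :: real
      using that assms(2) by (simp add: divide_simps) (simp add: algebra_simps)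
    from this[of "2 powr p" "(b - a) powr (p + 1)"] show ?thesis
      using assms(1) by (simp add: H_def powr_divide powr_add[of 2] mult.commute)
  qed
  with has_integral_combine[OF _ _ 1 2] m show ?thesis by simp
qed

section \<open>The inequality and its sharpness\<close>

lemma Lp_norm_bounded_variation:
  assumes ab: "a < b" and bv: "bounded_variation_on a b f" and p: "p \<ge> 1"
  shows "Lp_norm_on a b p f
    \<le> 1 / (b - a) powr (1 - 1 / p) * \<bar>integral {a..b} f\<bar>
      + 1 / 2 * ((b - a) powr (1 / p) * (2 powr (p + 1) - 1) powr (1 / p)
                  / (p + 1) powr (1 / p)) * total_variation a b f"
proof -
  define L V c where "L = b - a" and "V = total_variation a b f"
    and "c = \<bar>integral {a..b} f\<bar> / (b - a)"
  \<comment> \<open>\<open>u\<close> is the varying part of the pointwise bound and \<open>c\<close>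
    its constant part; Minkowski turns \<open>c\<close> into the mean term and \<open>u\<close> into
    the variation term.\<close>
  define u where "u t = V / L * max (t - a) (b - t)" for t
  have L: "L > 0" and c: "c \<ge> 0" using ab by (simp_all add: L_def c_def)
  have V: "V \<ge> 0"
    using abs_diff_le_total_variation_diff[OF bv, of a b] ab
    by (simp add: V_def total_variation_self)
  have u: "u t \<ge> 0" if "t \<in> {a..b}" for t
    using that V L by (auto simp: u_def)
  have bound: "\<bar>f t\<bar> \<le> c + u t" if "t \<in> {a..b}" for t
    using bounded_variation_on_mean_bound[OF bv ab that] by (simp add: c_def u_def L_def V_def)
  have int: "(\<lambda>t. (c + u t) powr p) integrable_on {a..b}"
    using p c u by (intro integrable_continuous_real continuous_on_powr')
      (use L in \<open>auto simp: u_def intro!: continuous_intros\<close>)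
  have intu: "((\<lambda>t. u t powr p) has_integral
      (V / L) powr p * (L powr (p + 1) * (2 powr (p + 1) - 1) / ((p + 1) * 2 powr p))) {a..b}"
    unfolding L_def
  proof (rule has_integral_eq)
    show "(V / (b - a)) powr p * max (t - a) (b - t) powr p = u t powr p" for t
      unfolding u_def L_def by (rule powr_mult[symmetric])
  qed (intro has_integral_mult_right has_integral_max_powr ab, use p in simp)
  have "Lp_norm_on a b p f \<le> (integral {a..b} (\<lambda>t. (c + u t) powr p)) powr (1 / p)"
    unfolding Lp_norm_on_def using bound p
    by (intro powr_mono2 integral_le integral_nonneg int bounded_variation_on_powr_integrable[OF bv])
      auto
  also have "\<dots> \<le> (integral {a..b} (\<lambda>t. c powr p)) powr (1 / p)
      + (integral {a..b} (\<lambda>t. u t powr p)) powr (1 / p)"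
    using p c u int intu by (intro Minkowski_inequality_integral) (auto simp: has_integral_iff)
  also have "(integral {a..b} (\<lambda>t. c powr p)) powr (1 / p) = c * L powr (1 / p)"
    using L c p by (simp add: L_def powr_mult powr_powr)
  also have "\<dots> = 1 / L powr (1 - 1 / p) * \<bar>integral {a..b} f\<bar>"
    using L by (simp add: c_def L_def powr_diff)
  \<comment> \<open>The exponent \<open>(p + 1) / p\<close> yields
    \<open>L * L powr (1 / p)\<close>, whose factor \<open>L\<close> cancels against
    \<open>V / L\<close>. The root of \<open>2 powr p\<close> is 2, the source of the constant
    1/2.\<close>
  also have "(integral {a..b} (\<lambda>t. u t powr p)) powr (1 / p)
      = V / L * (L * L powr (1 / p) * (2 powr (p + 1) - 1) powr (1 / p) / ((p + 1) powr (1 / p) * 2))"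
  proof -
    have "(2::real) powr (p + 1) \<ge> 1"
      using p by (intro ge_one_powr_ge_zero) auto
    then show ?thesis
      using L V p intu by (simp add: has_integral_iff powr_mult powr_divide powr_powr add_divide_distrib powr_add)
  qed
  also have "\<dots> = 1 / 2 * (L powr (1 / p) * (2 powr (p + 1) - 1) powr (1 / p)
                  / (p + 1) powr (1 / p)) * V"
    using L by (simp add: field_simps)
  finally show ?thesis by (simp add: L_def V_def)
qed

section \<open>Sharpness of the constant\<close>

lemma variation_sums_antimono:
  assumes "antimono f" "a < b"
  shows "variation_sums a b f = {f a - f b}"
proof -
  \<comment> \<open>For decreasing \<open>f\<close> all absolute values open with the same sign, so
    the sum telescopes and depends only on the endpoints.\<close>
  have "(\<Sum>i<n. \<bar>f (x (Suc i)) - f (x i)\<bar>) = f (x 0) - f (x n)"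
    if "\<forall>i<n. x i < x (Suc i)" for n and x :: "nat \<Rightarrow> real"
  proof -
    have "(\<Sum>i<n. \<bar>f (x (Suc i)) - f (x i)\<bar>) = (\<Sum>i<n. f (x i) - f (x (Suc i)))"
      using that antimonoD[OF assms(1)] by (intro sum.cong) (auto simp: less_imp_le)
    then show ?thesis using sum_lessThan_telescope'[of "\<lambda>i. f (x i)" n] by simp
  qed
  then have "variation_sums a b f \<subseteq> {f a - f b}"
    by (auto simp: variation_sums_def)
  then show ?thesis
    using variation_sums_nonempty[of a b f] assms(2) by auto
qed

text \<open>With \<open>P = 2 powr p\<close>, the numerator satisfies
  \<open>2 * P - 1 \<le> P * (p + 1)\<close> because \<open>p \<ge> 1\<close>. The left side tends
  to 2 as \<open>p\<close> grows, so the bound loses nothing in the limit.\<close>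

lemma Lp_constant_le_2:
  fixes p :: real
  assumes "p \<ge> 1"
  shows "(2 powr (p + 1) - 1) powr (1 / p) / (p + 1) powr (1 / p) \<le> 2"
proof -
  have ge: "(2::real) powr (p + 1) \<ge> 1"
    using assms by (intro ge_one_powr_ge_zero) auto
  have "2 powr (p + 1) - 1 \<le> 2 powr p * (p + 1)"
  proof -
    have "2 powr p * 2 \<le> 2 powr p * (p + 1)"
      using assms by (intro mult_left_mono) auto
    moreover have "2 powr (p + 1) = 2 powr p * (2::real)"
      by (simp add: powr_add)
    ultimately show ?thesis by linarith
  qed
  then have "(2 powr (p + 1) - 1) / (p + 1) \<le> 2 powr p"
    using assms by (simp add: pos_divide_le_eq)
  then have "((2 powr (p + 1) - 1) / (p + 1)) powr (1 / p) \<le> (2 powr p) powr (1 / p)"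
    using assms ge by (intro powr_mono2) auto
  then show ?thesis using assms ge by (simp add: powr_divide powr_powr)
qed

lemma has_integral_step_function:
  fixes e :: real
  assumes "0 \<le> e" "e \<le> 1"
  shows "((\<lambda>t. if t \<le> e then 1 else 0 :: real) has_integral e) {0..1}"
proof -
  have "((\<lambda>_. 1 :: real) has_integral e) {0..e}"
    using has_integral_const_real[of "1::real" 0 e] assms by simp
  then have "((\<lambda>t. if t \<in> {0..e} then 1 else 0 :: real) has_integral e) {0..1}"
    using assms by (subst has_integral_restrict) auto
  then show ?thesis by (rule has_integral_eq[rotated]) simp
qed

lemma Lp_constant_sharp:
  fixes D :: real
  assumes D: "D > 0"
    and ineq: "\<And>a b f p. a < b \<Longrightarrow> bounded_variation_on a b f \<Longrightarrow> p \<ge> 1 \<Longrightarrow>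
      Lp_norm_on a b p f
        \<le> 1 / (b - a) powr (1 - 1 / p) * \<bar>integral {a..b} f\<bar>
          + D * ((b - a) powr (1 / p) * (2 powr (p + 1) - 1) powr (1 / p)
                  / (p + 1) powr (1 / p)) * total_variation a b f"
  shows "D \<ge> 1 / 2"
proof -
  have main: "(1 / p) powr (1 / p) \<le> 1 / p + 2 * D" if p: "p \<ge> 1" for p :: real
  proof -
    \<comment> \<open>The width \<open>1 / p\<close> sends the integral to 0 while the norm
      \<open>(1 / p) powr (1 / p)\<close> still tends to 1, so for large \<open>p\<close> the
      variation term must carry the whole norm.\<close>
    define f :: "real \<Rightarrow> real" where "f t = (if t \<le> 1 / p then 1 else 0)" for t
    have int: "(f has_integral 1 / p) {0..1}"
      using has_integral_step_function[of "1 / p"] p by (simp add: f_def[abs_def])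
    have f0: "f 0 = 1" using p by (simp add: f_def)
    show ?thesis
    proof (cases "p = 1")
      \<comment> \<open>For \<open>p = 1\<close> the step fills \<open>{0..1}\<close> and
        \<open>f\<close> does not jump there; the claim is just
        \<open>1 \<le> 1 + 2 * D\<close>.\<close>
      case True
      then show ?thesis using D by simp
    next
      case False
      then have "f 1 = 0" using p by (simp add: f_def field_simps)
      then have vs: "variation_sums 0 1 f = {1}"
        using variation_sums_antimono[of f 0 1] f0 by (simp add: f_def antimono_def)
      \<comment> \<open>The values are 0 and 1, and \<open>0 powr p = 0\<close>.\<close>
      have "(\<lambda>t. \<bar>f t\<bar> powr p) = f"
        using p by (auto simp: f_def)
      then have "Lp_norm_on 0 1 p f = (1 / p) powr (1 / p)"
        using int by (simp add: Lp_norm_on_def has_integral_iff)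
      then have "(1 / p) powr (1 / p)
          \<le> 1 / p + D * ((2 powr (p + 1) - 1) powr (1 / p) / (p + 1) powr (1 / p))"
        using ineq[of 0 1 f p] p vs int
        by (simp add: bounded_variation_on_def total_variation_def has_integral_iff)
      also have "\<dots> \<le> 1 / p + D * 2"
        using Lp_constant_le_2[OF p] D by (intro add_left_mono mult_left_mono) auto
      finally show ?thesis by simp
    qed
  qed
  have lim: "((\<lambda>p::real. (1 / p) powr (1 / p)) \<longlongrightarrow> 1) at_top"
    "((\<lambda>p::real. 1 / p + 2 * D) \<longlongrightarrow> 2 * D) at_top"
    by real_asymp+
  have "1 \<le> 2 * D"
    by (rule tendsto_le[OF trivial_limit_at_top_linorder lim(2,1) eventually_mono[OF eventually_ge_at_top main]])
  then show ?thesis by simp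
qed

theorem theorem2:
  shows "(\<forall>(a::real) (b::real) (f::real \<Rightarrow> real) (p::real).
            a < b \<longrightarrow> bounded_variation_on a b f \<longrightarrow> p \<ge> 1 \<longrightarrow>
            Lp_norm_on a b p f
              \<le> 1 / (b - a) powr (1 - 1 / p) * \<bar>integral {a..b} f\<bar>
                + 1 / 2 * ((b - a) powr (1 / p) * (2 powr (p + 1) - 1) powr (1 / p)
                            / (p + 1) powr (1 / p)) * total_variation a b f)
       \<and> (\<forall>D::real. D > 0 \<longrightarrow>
            (\<forall>(a::real) (b::real) (f::real \<Rightarrow> real) (p::real).
               a < b \<longrightarrow> bounded_variation_on a b f \<longrightarrow> p \<ge> 1 \<longrightarrow>
               Lp_norm_on a b p f
                 \<le> 1 / (b - a) powr (1 - 1 / p) * \<bar>integral {a..b} f\<bar>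
                   + D * ((b - a) powr (1 / p) * (2 powr (p + 1) - 1) powr (1 / p)
                            / (p + 1) powr (1 / p)) * total_variation a b f)
            \<longrightarrow> D \<ge> 1 / 2)"
  using Lp_norm_bounded_variation Lp_constant_sharp by blast

end
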